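(* For every positive integer $n$, it is possible to construct a quantum circuit that implements the $n$-qubit Toffoli gate $C^nX$ using one clean ancilla qubit, with a total of $6n+2$ CNOT gates (together with single-qubit gates) and depth $\mathcal{O}(\log n)$.
   Context: Circuits are built from arbitrary single-qubit unitary gates and CNOT gates (between arbitrary pairs of qubits). The CNOT count is the number of CNOT gates used. The depth is the minimal number of layers into which the gates can be arranged so that gates in the same layer act on disjoint qubits. The bound $\mathcal{O}(\log n)$ is with an absolute constant and is understood up to an additive constant, i.e. depth $\le C(1+\log n)$. The $n$-qubit Toffoli gate $C^nX$ has $n$ control qubits and one target qubit: it applies $X=\sigma_x$ to the target if all $n$ controls are in state $|1\rangle$, and acts as the identity on the computational basis states for which some control is $|0\rangle$. A clean ancilla is an additional qubit, initialized in $|0\rangle$ and returned to $|0\rangle$ at the end of the circuit; so a circuit $V$ on $n+2$ qubits implements $C^nX$ with one clean ancilla if $V(|\psi\rangle\otimes|0\rangle)=(C^nX|\psi\rangle)\otimes|0\rangle$ for every state $|\psi\rangle$ of the $n+1$ control and target qubits. *)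

theory Defs
  imports Complex_Main "Jordan_Normal_Form.Schur_Decomposition"
begin

text \<open>
  The computational basis state of \<open>m\<close> qubits in which qubit \<open>q < m\<close> has value \<open>bit i q\<close> is
  the \<open>i\<close>-th unit vector of dimension \<open>2 ^ m\<close>, for \<open>i < 2 ^ m\<close>. So qubit \<open>0\<close> is the least
  significant bit of the index.
\<close>

definition qubit_states :: "nat \<Rightarrow> complex vec set" where
  "qubit_states m = {\<psi> \<in> carrier_vec (2 ^ m). \<psi> \<bullet>c \<psi> = 1}"

definition unitary_mat :: "nat \<Rightarrow> complex mat \<Rightarrow> bool" where
  "unitary_mat d U \<longleftrightarrow>
     U \<in> carrier_mat d d \<and> U * mat_adjoint U = 1\<^sub>m d \<and> mat_adjoint U * U = 1\<^sub>m d"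

text \<open>
  Tensor product of vectors. Since qubit \<open>0\<close> is the least significant bit, the left factor,
  which holds the lower-numbered qubits, occupies the low part of the index.
\<close>

definition tensor_vec :: "complex vec \<Rightarrow> complex vec \<Rightarrow> complex vec" where
  "tensor_vec v w =
     vec (dim_vec v * dim_vec w) (\<lambda>i. v $ (i mod dim_vec v) * w $ (i div dim_vec v))"

definition ket0 :: "complex vec" where
  "ket0 = unit_vec 2 0"

definition basis_map_mat :: "nat \<Rightarrow> (nat \<Rightarrow> nat) \<Rightarrow> complex mat" where
  "basis_map_mat m f = mat (2 ^ m) (2 ^ m) (\<lambda>(i, j). if i = f j then 1 else 0)"

datatype gate =
    Single "complex mat" nat
  | is_CNOT: CNOT nat nat

fun gate_qubits :: "gate \<Rightarrow> nat set" where
  "gate_qubits (Single U q) = {q}"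
| "gate_qubits (CNOT c t) = {c, t}"

fun valid_gate :: "nat \<Rightarrow> gate \<Rightarrow> bool" where
  "valid_gate m (Single U q) \<longleftrightarrow> unitary_mat 2 U \<and> q < m"
| "valid_gate m (CNOT c t) \<longleftrightarrow> c < m \<and> t < m \<and> c \<noteq> t"

fun gate_mat :: "nat \<Rightarrow> gate \<Rightarrow> complex mat" where
  "gate_mat m (Single U q) =
     mat (2 ^ m) (2 ^ m) (\<lambda>(i, j).
       if unset_bit q i = unset_bit q j
       then U $$ (of_bool (bit i q), of_bool (bit j q)) else 0)"
| "gate_mat m (CNOT c t) = basis_map_mat m (\<lambda>j. if bit j c then flip_bit t j else j)"

text \<open>A circuit is the list of its gates, the head being applied first.\<close>

type_synonym circuit = "gate list"

definition valid_circuit :: "nat \<Rightarrow> circuit \<Rightarrow> bool" where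
  "valid_circuit m gs \<longleftrightarrow> (\<forall>g \<in> set gs. valid_gate m g)"

fun circuit_mat :: "nat \<Rightarrow> circuit \<Rightarrow> complex mat" where
  "circuit_mat m [] = 1\<^sub>m (2 ^ m)"
| "circuit_mat m (g # gs) = circuit_mat m gs * gate_mat m g"

definition cnot_count :: "circuit \<Rightarrow> nat" where
  "cnot_count gs = length (filter is_CNOT gs)"

text \<open>
  An arrangement into \<open>d\<close> layers assigns a layer to each gate. Gates sharing a qubit must be in
  different layers and stay in their original order, so that the arrangement still describes
  the same circuit; all gates, including single-qubit ones, are counted.
\<close>

definition layering :: "circuit \<Rightarrow> nat \<Rightarrow> (nat \<Rightarrow> nat) \<Rightarrow> bool" where
  "layering gs d L \<longleftrightarrow>
     (\<forall>i < length gs. L i < d) \<and>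
     (\<forall>i j. i < j \<and> j < length gs \<and> gate_qubits (gs ! i) \<inter> gate_qubits (gs ! j) \<noteq> {}
        \<longrightarrow> L i < L j)"

definition depth :: "circuit \<Rightarrow> nat" where
  "depth gs = (LEAST d. \<exists>L. layering gs d L)"

text \<open>The controls are the qubits \<open>0, \<dots>, n - 1\<close> and the target is qubit \<open>n\<close>.\<close>

definition toffoli :: "nat \<Rightarrow> complex mat" where
  "toffoli n = basis_map_mat (n + 1) (\<lambda>j. if \<forall>k < n. bit j k then flip_bit n j else j)"

text \<open>The clean ancilla is qubit \<open>n + 1\<close>.\<close>

definition implements_toffoli_clean_ancilla :: "nat \<Rightarrow> circuit \<Rightarrow> bool" where
  "implements_toffoli_clean_ancilla n gs \<longleftrightarrow>
     valid_circuit (n + 2) gs \<and>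
     (\<forall>\<psi> \<in> qubit_states (n + 1).
        circuit_mat (n + 2) gs *\<^sub>v tensor_vec \<psi> ket0 = tensor_vec (toffoli n *\<^sub>v \<psi>) ket0)"

end

theory Submission
  imports Defs
begin

text \<open>
  The conjunction of the controls is computed by Toffoli gates that are only correct up to phase and
  cost three CNOT gates; conjugating the final gate by them cancels the phases. The first one
  writes the conjunction of two controls to the ancilla \<open>a\<close>. If \<open>a = 1\<close> then both controls are known
  to be \<open>1\<close>, so they can be used as clean targets for further conjunctions, and if \<open>a = 0\<close> it does not
  matter what happens to them. Repeating this, the number of such conditionally clean qubits
  can be doubled in constant depth, which gives logarithmic depth. After \<open>n - 3\<close> such gates three qubits
  remain whose conjunction is that of all controls; an exact Toffoli gate with three
  controls and one dirty ancilla takes \<open>18\<close> CNOT gates, which together with \<open>6 (n - 3)\<close> gates makes \<open>6 n\<close>,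
  and a cancelling pair of CNOT gates gives \<open>6 n + 2\<close>.
\<close>

section \<open>Elementary gates and conjunction operations\<close>

definition inv_sqrt2 :: complex where
  "inv_sqrt2 = complex_of_real (1 / sqrt 2)"

definition hadamard :: "complex mat" where
  "hadamard = mat 2 2 (\<lambda>(i, j). if i = 1 \<and> j = 1 then - inv_sqrt2 else inv_sqrt2)"

definition phase_mat :: "complex \<Rightarrow> complex mat" where
  "phase_mat p = mat 2 2 (\<lambda>(i, j). if i \<noteq> j then 0 else if i = 0 then 1 else p)"

definition pauli_x :: "complex mat" where
  "pauli_x = mat 2 2 (\<lambda>(i, j). if i = j then 0 else 1)"

text \<open>This is the eighth root of unity \<open>exp (i pi / 4)\<close>.\<close>

definition t_phase :: complex where
  "t_phase = Complex (1 / sqrt 2) (1 / sqrt 2)"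

abbreviation T_gate :: "nat \<Rightarrow> gate" where
  "T_gate \<equiv> Single (phase_mat t_phase)"

abbreviation Tdg_gate :: "nat \<Rightarrow> gate" where
  "Tdg_gate \<equiv> Single (phase_mat (cnj t_phase))"

type_synonym op = "nat \<times> nat \<times> nat"

text \<open>An operation \<open>(u, v, w)\<close> replaces \<open>w\<close> by \<open>w \<longleftrightarrow> u \<and> v\<close>: a target in state \<open>1\<close> receives the
  conjunction, and the all-ones state is fixed. This is why \<open>1\<close>, not \<open>0\<close>, is the clean value below.\<close>

fun op_fun :: "op \<Rightarrow> nat \<Rightarrow> nat" where
  "op_fun (u, v, w) i = (if bit i u \<and> bit i v then i else flip_bit w i)"

fun op_qubits :: "op \<Rightarrow> nat set" where
  "op_qubits (u, v, w) = {u, v, w}"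

fun distinct_op :: "op \<Rightarrow> bool" where
  "distinct_op (u, v, w) \<longleftrightarrow> u \<noteq> v \<and> u \<noteq> w \<and> v \<noteq> w"

text \<open>The relative-phase Toffoli gate with three CNOT gates, followed by \<open>X\<close> on its target.\<close>

fun op_circuit :: "op \<Rightarrow> circuit" where
  "op_circuit (u, v, w) =
     [Single hadamard w, T_gate w, CNOT v w, Tdg_gate w, CNOT u w,
      T_gate w, CNOT v w, Tdg_gate w, Single hadamard w, Single pauli_x w]"

definition ops_fun :: "op list \<Rightarrow> nat \<Rightarrow> nat" where
  "ops_fun os = fold op_fun os"

definition ops_qubits :: "op list \<Rightarrow> nat set" where
  "ops_qubits os = (\<Union>p\<in>set os. op_qubits p)"

definition ops_circuit :: "op list \<Rightarrow> circuit" where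
  "ops_circuit os = concat (map op_circuit os)"

lemma ops_fun_simps [simp]:
  "ops_fun [] i = i"
  "ops_fun (p # os) i = ops_fun os (op_fun p i)"
  "ops_fun (a @ b) i = ops_fun b (ops_fun a i)"
  by (simp_all add: ops_fun_def)

lemma ops_qubits_simps [simp]:
  "ops_qubits [] = {}"
  "ops_qubits (p # os) = op_qubits p \<union> ops_qubits os"
  "ops_qubits (a @ b) = ops_qubits a \<union> ops_qubits b"
  by (simp_all add: ops_qubits_def)

lemma ops_circuit_simps [simp]:
  "ops_circuit [] = []"
  "ops_circuit (p # os) = op_circuit p @ ops_circuit os"
  "ops_circuit (a @ b) = ops_circuit a @ ops_circuit b"
  by (simp_all add: ops_circuit_def)

section \<open>Layers of circuits\<close>

definition circuit_qubits :: "circuit \<Rightarrow> nat set" where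
  "circuit_qubits gs = (\<Union>g\<in>set gs. gate_qubits g)"

text \<open>Upper bounds witnessed by a layering compose under concatenation, overlay and reversal,
  so \<open>LEAST\<close> is only met in \<open>depth_le\<close>.\<close>

definition layers_suffice :: "circuit \<Rightarrow> nat \<Rightarrow> bool" where
  "layers_suffice gs d \<longleftrightarrow> (\<exists>L. layering gs d L)"

lemma depth_le: "layers_suffice gs d \<Longrightarrow> depth gs \<le> d"
  unfolding depth_def layers_suffice_def by (rule Least_le)

lemma layers_suffice_mono: "layers_suffice gs d \<Longrightarrow> d \<le> e \<Longrightarrow> layers_suffice gs e"
  unfolding layers_suffice_def layering_def by (auto intro: order_less_le_trans)

lemma layers_suffice_length: "layers_suffice gs (length gs)"
  unfolding layers_suffice_def layering_def by (rule exI[of _ "\<lambda>i. i"]) auto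

lemma layers_suffice_append:
  assumes "layers_suffice a d" "layers_suffice b e"
  shows "layers_suffice (a @ b) (d + e)"
proof -
  obtain L M where L: "layering a d L" and M: "layering b e M"
    using assms by (auto simp: layers_suffice_def)
  have "layering (a @ b) (d + e) (\<lambda>i. if i < length a then L i else d + M (i - length a))"
    unfolding layering_def
  proof (intro conjI allI impI)
    fix i assume "i < length (a @ b)"
    then show "(if i < length a then L i else d + M (i - length a)) < d + e"
      using L M by (auto simp: layering_def trans_less_add1)
  next
    fix i j
    assume ij: "i < j \<and> j < length (a @ b) \<and>
      gate_qubits ((a @ b) ! i) \<inter> gate_qubits ((a @ b) ! j) \<noteq> {}"
    consider "j < length a" | "i < length a" "\<not> j < length a" | "\<not> i < length a" by blast
    then show "(if i < length a then L i else d + M (i - length a))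
      < (if j < length a then L j else d + M (j - length a))"
    proof cases
      case 1
      then have "gate_qubits (a ! i) \<inter> gate_qubits (a ! j) \<noteq> {}" using ij by (auto simp: nth_append)
      then have "L i < L j" using 1 ij L unfolding layering_def by blast
      then show ?thesis using 1 ij by simp
    next
      case 2
      then show ?thesis using L by (auto simp: layering_def trans_less_add1)
    next
      case 3
      then have "i - length a < j - length a" "j - length a < length b"
        "gate_qubits (b ! (i - length a)) \<inter> gate_qubits (b ! (j - length a)) \<noteq> {}"
        using ij by (auto simp: nth_append)
      then have "M (i - length a) < M (j - length a)" using M unfolding layering_def by blast
      then show ?thesis using 3 ij by simp
    qed
  qed
  then show ?thesis by (auto simp: layers_suffice_def)
qed

text \<open>With disjoint qubits no ordering constraint links the two circuits, so their layerings
  can be overlaid. All savings over linear depth come from here.\<close>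

lemma layers_suffice_parallel:
  assumes "layers_suffice a d" "layers_suffice b d" "circuit_qubits a \<inter> circuit_qubits b = {}"
  shows "layers_suffice (a @ b) d"
proof -
  obtain L M where L: "layering a d L" and M: "layering b d M"
    using assms by (auto simp: layers_suffice_def)
  have "layering (a @ b) d (\<lambda>i. if i < length a then L i else M (i - length a))"
    unfolding layering_def
  proof (intro conjI allI impI)
    fix i assume "i < length (a @ b)"
    then show "(if i < length a then L i else M (i - length a)) < d"
      using L M by (auto simp: layering_def)
  next
    fix i j
    assume ij: "i < j \<and> j < length (a @ b) \<and>
      gate_qubits ((a @ b) ! i) \<inter> gate_qubits ((a @ b) ! j) \<noteq> {}"
    consider "j < length a" | "i < length a" "\<not> j < length a" | "\<not> i < length a" by blast
    then show "(if i < length a then L i else M (i - length a))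
      < (if j < length a then L j else M (j - length a))"
    proof cases
      case 1
      then have "gate_qubits (a ! i) \<inter> gate_qubits (a ! j) \<noteq> {}" using ij by (auto simp: nth_append)
      then have "L i < L j" using 1 ij L unfolding layering_def by blast
      then show ?thesis using 1 ij by simp
    next
      case 2
      then have "gate_qubits (a ! i) \<subseteq> circuit_qubits a"
        "gate_qubits (b ! (j - length a)) \<subseteq> circuit_qubits b"
        using ij by (auto simp: circuit_qubits_def)
      then show ?thesis using 2 ij assms(3) by (auto simp: nth_append)
    next
      case 3
      then have "i - length a < j - length a" "j - length a < length b"
        "gate_qubits (b ! (i - length a)) \<inter> gate_qubits (b ! (j - length a)) \<noteq> {}"
        using ij by (auto simp: nth_append)
      then have "M (i - length a) < M (j - length a)" using M unfolding layering_def by blast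
      then show ?thesis using 3 ij by simp
    qed
  qed
  then show ?thesis by (auto simp: layers_suffice_def)
qed

section \<open>Conjunctions with conditionally clean qubits\<close>

lemma circuit_qubits_ops: "circuit_qubits (ops_circuit os) = ops_qubits os"
proof (induction os)
  case (Cons p os)
  then show ?case by (cases p) (auto simp: circuit_qubits_def)
qed (simp add: circuit_qubits_def)

lemma length_ops_circuit: "length (ops_circuit os) = 10 * length os"
proof (induction os)
  case (Cons p os)
  then show ?case by (cases p) simp
qed simp

lemma layers_suffice_op: "layers_suffice (op_circuit p) 10"
proof -
  have "length (op_circuit p) = 10" by (cases p) simp
  then show ?thesis using layers_suffice_length[of "op_circuit p"] by simp
qed

lemma bit_op_fun:
  "bit (op_fun (u, v, w) i) q \<longleftrightarrow>
    (if q = w then bit i w \<longleftrightarrow> bit i u \<and> bit i v else bit i q)"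
  by (auto simp: bit_flip_bit_iff)

lemma bit_op_fun_other: "q \<notin> op_qubits p \<Longrightarrow> bit (op_fun p i) q = bit i q"
  by (cases p) (simp only: bit_op_fun op_qubits.simps, auto)

lemma bit_ops_fun_other: "q \<notin> ops_qubits os \<Longrightarrow> bit (ops_fun os i) q = bit i q"
  by (induction os arbitrary: i) (auto simp: bit_op_fun_other)

lemma ops_fun_ones: "(\<And>q. q \<in> ops_qubits os \<Longrightarrow> bit i q) \<Longrightarrow> ops_fun os i = i"
proof (induction os)
  case (Cons p os)
  then have "op_fun p i = i" by (cases p) auto
  with Cons show ?case by simp
qed simp

lemma op_fun_commute:
  assumes "op_qubits p \<inter> op_qubits r = {}"
  shows "op_fun p (op_fun r i) = op_fun r (op_fun p i)"
proof (cases p, cases r)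
  fix u v w u' v' w' assume "p = (u, v, w)" "r = (u', v', w')"
  then show ?thesis using assms
    by (intro bit_eqI) (simp only: bit_op_fun, auto)
qed

lemma ops_fun_op_fun_commute:
  "ops_qubits os \<inter> op_qubits p = {} \<Longrightarrow> ops_fun os (op_fun p i) = op_fun p (ops_fun os i)"
proof (induction os arbitrary: i)
  case (Cons r os)
  then have "op_qubits r \<inter> op_qubits p = {}" by auto
  with Cons show ?case by (auto simp: op_fun_commute Int_Un_distrib2)
qed simp

lemma ops_fun_commute:
  "ops_qubits a \<inter> ops_qubits b = {} \<Longrightarrow> ops_fun a (ops_fun b i) = ops_fun b (ops_fun a i)"
proof (induction b arbitrary: i)
  case (Cons r b)
  then have "ops_qubits a \<inter> op_qubits r = {}" by auto
  with Cons show ?case by (auto simp: ops_fun_op_fun_commute Int_Un_distrib)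
qed simp

text \<open>\<open>X\<close> holds the bits to be conjoined, \<open>K\<close> the clean qubits and
  \<open>z\<close> the result. Only \<open>z\<close> is specified, since all other changes are
  undone later by the inverse circuit. Each operation merges two results into one, hence the exact
  count \<open>card X - 1\<close>, that of the inner nodes of a binary tree with leaves
  \<open>X\<close>.\<close>

definition reduces :: "op list \<Rightarrow> nat set \<Rightarrow> nat set \<Rightarrow> nat \<Rightarrow> bool" where
  "reduces os X K z \<longleftrightarrow>
     (\<forall>p\<in>set os. distinct_op p) \<and> ops_qubits os \<subseteq> X \<union> K \<and> z \<in> X \<union> K \<and>
     length os + 1 = card X \<and>
     (\<forall>i. (\<forall>k\<in>K. bit i k) \<longrightarrow> (bit (ops_fun os i) z \<longleftrightarrow> (\<forall>x\<in>X. bit i x)))"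

lemma reduces_singleton: "reduces [] {x} K x"
  by (simp add: reduces_def)

lemma reduces_mono: "reduces os X K z \<Longrightarrow> K \<subseteq> K' \<Longrightarrow> reduces os X K' z"
  unfolding reduces_def by blast

text \<open>This allows commuting operations to be reordered for the sake of depth.\<close>

lemma reduces_cong:
  assumes "reduces a X K z" "set b = set a" "length b = length a" "\<And>i. ops_fun b i = ops_fun a i"
  shows "reduces b X K z"
  using assms by (simp add: reduces_def ops_qubits_def)

text \<open>If the result bit \<open>x\<close> of the first reduction is \<open>1\<close> then all its qubits were \<open>1\<close>, and are
  still \<open>1\<close> because every operation fixes the all-ones state. So they can serve as clean qubits
  in the second reduction; if \<open>x\<close> is \<open>0\<close>, the result of the second reduction does not matter.\<close>

lemma reduces_join:
  assumes a: "reduces a X K x" and b: "reduces b Y L y"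
    and XY: "X \<inter> Y = {}" and J: "(X \<union> Y) \<inter> J = {}" "K \<subseteq> J" "L \<subseteq> X \<union> J" "x \<notin> L"
    and e: "e \<in> J" "e \<notin> K \<union> L" and fin: "finite X" "finite Y"
  shows "reduces (a @ b @ [(x, y, e)]) (X \<union> Y) J e"
proof -
  have x: "x \<in> X \<union> K" and y: "y \<in> Y \<union> L" and qa: "ops_qubits a \<subseteq> X \<union> K" and qb: "ops_qubits b \<subseteq> Y \<union> L"
    using a b by (auto simp: reduces_def)
  have xny: "x \<notin> Y \<union> L" using x XY J by auto
  have ex: "e \<notin> X \<union> K" and ey: "e \<notin> Y \<union> L" using e J by auto
  have d: "distinct_op (x, y, e)" using x y xny ex ey by auto
  have len: "length (a @ b @ [(x, y, e)]) + 1 = card (X \<union> Y)"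
    using a b card_Un_disjoint[OF fin XY] by (auto simp: reduces_def)
  have spec: "bit (ops_fun (a @ b @ [(x, y, e)]) i) e \<longleftrightarrow> (\<forall>x\<in>X \<union> Y. bit i x)"
    if ones: "\<forall>k\<in>J. bit i k" for i
  proof -
    have "bit (ops_fun b (ops_fun a i)) e"
      using ones e qa qb ex ey by (subst bit_ops_fun_other, blast)+ blast
    then have 1: "bit (ops_fun (a @ b @ [(x, y, e)]) i) e \<longleftrightarrow>
      bit (ops_fun b (ops_fun a i)) x \<and> bit (ops_fun b (ops_fun a i)) y"
      by (auto simp: bit_flip_bit_iff)
    have 2: "bit (ops_fun b (ops_fun a i)) x \<longleftrightarrow> (\<forall>x\<in>X. bit i x)"
    proof -
      have "x \<notin> ops_qubits b" "\<forall>k\<in>K. bit i k" using xny qb ones J by auto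
      then show ?thesis using a by (simp add: bit_ops_fun_other reduces_def)
    qed
    show ?thesis
    proof (cases "\<forall>x\<in>X. bit i x")
      case True
      then have "ops_fun a i = i" using ones J qa by (intro ops_fun_ones) blast
      moreover have "\<forall>k\<in>L. bit i k" using True ones J by blast
      ultimately have "bit (ops_fun b (ops_fun a i)) y \<longleftrightarrow> (\<forall>x\<in>Y. bit i x)"
        using b by (simp add: reduces_def)
      with 1 2 True show ?thesis by auto
    qed (use 1 2 in auto)
  qed
  show ?thesis unfolding reduces_def
    using a b d len spec e J(2,3) x y qa qb
    by (intro conjI) (auto simp: reduces_def)
qed

lemma reduces_pair:
  assumes "x \<noteq> y" "x \<notin> J" "y \<notin> J" "e \<in> J"
  shows "reduces [(x, y, e)] {x, y} J e"
  using reduces_join[OF reduces_singleton[of x "{}"] reduces_singleton[of y "{}"], of J e] assms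
  by (simp add: insert_commute)

text \<open>One clean qubit receives the conjunction of \<open>x\<close> and \<open>y\<close>, which
  thereby become the two conditionally clean qubits for the rest; the other clean qubit receives the
  final conjunction. The depth is linear, so this serves only for pieces of bounded size.\<close>

lemma ladder:
  assumes "finite X" "X \<noteq> {}" "card K = 2" "X \<inter> K = {}"
  shows "\<exists>os z. reduces os X K z"
  using assms
proof (induction "card X" arbitrary: X K rule: less_induct)
  case less
  obtain c d where K: "K = {c, d}" "c \<noteq> d" using less.prems(3) by (auto simp: card_2_iff)
  obtain x where x: "x \<in> X" using less.prems by blast
  show ?case
  proof (cases "X = {x}")
    case True
    then show ?thesis using reduces_singleton by blast
  next
    case False
    then obtain y where y: "y \<in> X" "y \<noteq> x" using x by blast
    then have p: "reduces [(x, y, c)] {x, y} {c} c"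
      using x less.prems K by (intro reduces_pair) auto
    define Y where "Y = X - {x, y}"
    have X: "X = {x, y} \<union> Y" using x y by (auto simp: Y_def)
    show ?thesis
    proof (cases "Y = {}")
      case True
      then show ?thesis using X reduces_mono[OF p, of K] K by auto
    next
      case False
      have "card Y < card X" using less.prems x by (auto simp: Y_def intro!: psubset_card_mono)
      then obtain os z where "reduces os Y {x, y} z"
        using less.hyps[of Y "{x, y}"] less.prems False y by (auto simp: Y_def card_insert_if)
      then have "reduces ([(x, y, c)] @ os @ [(c, z, d)]) ({x, y} \<union> Y) K d"
        using less.prems K x y by (intro reduces_join[OF p]) (auto simp: Y_def)
      then show ?thesis using X by auto
    qed
  qed
qed

lemma reduces_length_layers:
  assumes "reduces os X K z" "card X \<le> n"
  shows "layers_suffice (ops_circuit os) (10 * n)"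
  using assms layers_suffice_length[of "ops_circuit os"]
  by (auto simp: reduces_def length_ops_circuit elim!: layers_suffice_mono)

text \<open>Here \<open>p\<close> reduces pieces of at most six qubits with two clean qubits each, in constant depth,
  \<open>q\<close> is a binary tree combining the results of the pieces, and \<open>A\<close> is not touched by \<open>q\<close>.\<close>

lemma block:
  assumes "finite X" "X \<noteq> {}" "card X \<le> 6 * 2 ^ i" "finite K" "card K + 1 = 3 * 2 ^ i" "X \<inter> K = {}"
  shows "\<exists>p q z A. reduces (p @ q) X K z \<and> layers_suffice (ops_circuit p) 60 \<and>
    layers_suffice (ops_circuit q) (10 * i) \<and>
    A \<subseteq> X \<union> K \<and> card X \<le> card A \<and> A \<inter> (ops_qubits q \<union> {z}) = {}"
  using assms
proof (induction i arbitrary: X K)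
  case 0
  then obtain p z where p: "reduces p X K z" using ladder[of X K] by auto
  \<comment> \<open>Here \<open>q\<close> is empty, so \<open>A\<close> only has to avoid
    \<open>z\<close>, and \<open>card X + 1\<close> qubits or more remain.\<close>
  define A where "A = X \<union> K - {z}"
  have "card (X \<union> K) = card X + 2" using 0 by (subst card_Un_disjoint) auto
  then have "card X \<le> card A"
    using p 0 by (auto simp: A_def reduces_def card_Diff_singleton)
  then show ?case
    using p reduces_length_layers[OF p 0(3)] layers_suffice_length[of "[]"]
    by (intro exI[of _ p] exI[of _ "[]"] exI[of _ z] exI[of _ A]) (auto simp: A_def)
next
  case (Suc i)
  show ?case
  \<comment> \<open>A single qubit cannot be halved, but is its own conjunction; all of
    \<open>K\<close> is then untouched.\<close>
  proof (cases "card X = 1")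
    case True
    then obtain x where X: "X = {x}" by (auto simp: card_1_singleton_iff)
    have "(2::nat) ^ i \<ge> 1" by simp
    then have "card K \<ge> 1" using Suc.prems(5) unfolding power_Suc by linarith
    then show ?thesis
      using X reduces_singleton[of x K] Suc.prems layers_suffice_length[of "[]"]
        layers_suffice_mono[OF layers_suffice_length[of "[]"]]
      by (intro exI[of _ "[]"] exI[of _ x] exI[of _ K]) auto
  next
    case False
    define h where "h = card X div 2"
    have h: "1 \<le> h" "h < card X" "h \<le> 6 * 2 ^ i" "card X - h \<le> 6 * 2 ^ i"
      using False Suc.prems(1-3) card_gt_0_iff[of X] by (auto simp: h_def)
    obtain X1 where X1: "X1 \<subseteq> X" "card X1 = h" using h by (meson obtain_subset_with_card_n less_imp_le)
    define X2 where "X2 = X - X1"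
    have fX: "finite X1" "finite X2" using X1 Suc.prems finite_subset by (auto simp: X2_def)
    have X2: "card X2 = card X - h" using X1 fX by (simp add: X2_def card_Diff_subset)
    have X: "X = X1 \<union> X2" "X1 \<inter> X2 = {}" using X1 by (auto simp: X2_def)
    \<comment> \<open>The supply splits as
      \<open>3 * 2 ^ Suc i - 1 = 2 * (3 * 2 ^ i - 1) + 1\<close>: one share per half, and
      \<open>e\<close> for the conjunction of the halves. Unfolded, this is two clean qubits for
      each of up to \<open>2 ^ i\<close> pieces and one for each inner node of the tree.\<close>
    have "3 * 2 ^ i - 1 \<le> card K" using Suc.prems(5) by simp
    then obtain K1 where K1: "K1 \<subseteq> K" "card K1 = 3 * 2 ^ i - 1"
      by (meson obtain_subset_with_card_n)
    have fK: "finite K1" using K1 Suc.prems finite_subset by auto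
    have K': "card (K - K1) = 3 * 2 ^ i"
      using K1 fK Suc.prems(5) by (simp add: card_Diff_subset)
    moreover have "(2::nat) ^ i \<ge> 1" by simp
    ultimately obtain e where e: "e \<in> K - K1" by (metis card.empty ex_in_conv mult_eq_0_iff not_one_le_zero zero_neq_numeral)
    define K2 where "K2 = K - K1 - {e}"
    have K2: "card K2 = 3 * 2 ^ i - 1" "finite K2"
      using K' e Suc.prems by (auto simp: K2_def card_Diff_singleton)
    have K: "K = K1 \<union> K2 \<union> {e}" "K1 \<inter> K2 = {}" "e \<notin> K1 \<union> K2" using K1 e by (auto simp: K2_def)
    have pow: "(2::nat) ^ i \<ge> 1" by simp
    have "X1 \<noteq> {}" "X2 \<noteq> {}" using X1 X2 h by auto
    have d1: "X1 \<inter> K1 = {}" "X2 \<inter> K2 = {}" "X1 \<inter> K2 = {}" "X2 \<inter> K1 = {}" "e \<notin> X1" "e \<notin> X2"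
      using X K Suc.prems(6) by auto
    obtain p1 q1 z1 A1 where 1: "reduces (p1 @ q1) X1 K1 z1" "layers_suffice (ops_circuit p1) 60"
      "layers_suffice (ops_circuit q1) (10 * i)"
      "A1 \<subseteq> X1 \<union> K1" "card X1 \<le> card A1" "A1 \<inter> (ops_qubits q1 \<union> {z1}) = {}"
      using Suc.IH[of X1 K1] X1 h K1 fX fK d1 \<open>X1 \<noteq> {}\<close> pow by auto
    obtain p2 q2 z2 A2 where 2: "reduces (p2 @ q2) X2 K2 z2" "layers_suffice (ops_circuit p2) 60"
      "layers_suffice (ops_circuit q2) (10 * i)"
      "A2 \<subseteq> X2 \<union> K2" "card X2 \<le> card A2" "A2 \<inter> (ops_qubits q2 \<union> {z2}) = {}"
      using Suc.IH[of X2 K2] X2 h K2 fX d1 \<open>X2 \<noteq> {}\<close> pow by auto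
    have Q1: "ops_qubits p1 \<subseteq> X1 \<union> K1" "ops_qubits q1 \<subseteq> X1 \<union> K1" "z1 \<in> X1 \<union> K1"
      and Q2: "ops_qubits p2 \<subseteq> X2 \<union> K2" "ops_qubits q2 \<subseteq> X2 \<union> K2" "z2 \<in> X2 \<union> K2"
      using 1 2 by (auto simp: reduces_def)
    have disj: "(X1 \<union> K1) \<inter> (X2 \<union> K2) = {}" using X K d1 by auto
    let ?p = "p1 @ p2" and ?q = "(q1 @ q2) @ [(z1, z2, e)]"
    have "reduces ((p1 @ q1) @ (p2 @ q2) @ [(z1, z2, e)]) (X1 \<union> X2) K e"
      using X K d1 fX disj Q1 Suc.prems(6) by (intro reduces_join[OF 1(1) 2(1)]) auto
    \<comment> \<open>Moving \<open>p2\<close> ahead of \<open>q1\<close> lets both constant-depth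
      phases share the first 60 layers and both trees run in parallel afterwards.\<close>
    moreover have "ops_qubits q1 \<inter> ops_qubits p2 = {}" using Q1 Q2 disj by blast
    then have "ops_fun q1 (ops_fun p2 j) = ops_fun p2 (ops_fun q1 j)" for j
      by (rule ops_fun_commute)
    ultimately have r: "reduces (?p @ ?q) X K e"
      unfolding X(1) by (elim reduces_cong) auto
    have s1: "layers_suffice (ops_circuit ?p) 60"
      unfolding ops_circuit_simps using Q1 Q2 disj
      by (intro layers_suffice_parallel 1 2) (auto simp: circuit_qubits_ops)
    have "layers_suffice (ops_circuit (q1 @ q2)) (10 * i)"
      unfolding ops_circuit_simps using Q1 Q2 disj
      by (intro layers_suffice_parallel 1 2) (auto simp: circuit_qubits_ops)
    then have "layers_suffice (ops_circuit ?q) (10 * i + 10)"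
      unfolding ops_circuit_simps(3)[of "q1 @ q2"]
      by (rule layers_suffice_append) (simp only: ops_circuit_simps append_Nil2 layers_suffice_op)
    then have s2: "layers_suffice (ops_circuit ?q) (10 * Suc i)" by (metis mult_Suc_right add.commute)
    have s3: "card X \<le> card (A1 \<union> A2)"
    proof -
      have "finite A1" "finite A2" using 1 2 fX fK K2 by (meson finite_UnI finite_subset)+
      moreover have "A1 \<inter> A2 = {}" using 1 2 disj by blast
      ultimately have "card (A1 \<union> A2) = card A1 + card A2" by (simp add: card_Un_disjoint)
      then show ?thesis using 1 2 X1 X2 h by simp
    qed
    have s4: "(A1 \<union> A2) \<inter> (ops_qubits ?q \<union> {e}) = {}"
    proof -
      have "A1 \<inter> ops_qubits q2 = {}" "A2 \<inter> ops_qubits q1 = {}" "z1 \<notin> A2" "z2 \<notin> A1"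
        "e \<notin> A1" "e \<notin> A2"
        using 1(4) 2(4) Q1 Q2 disj K(3) d1(5,6) by blast+
      then show ?thesis using 1(6) 2(6) by auto
    qed
    have s5: "A1 \<union> A2 \<subseteq> X \<union> K" using 1 2 X K by blast
    show ?thesis using r s1 s2 s3 s4 s5 by blast
  qed
qed

text \<open>A block of \<open>6 * 2 ^ i\<close> qubits leaves at least \<open>6 * 2 ^ i\<close> qubits that can serve as clean ones, twice
  as many as it was given. They are not touched by the tree \<open>q\<close> that combines the results of
  the block, so the remaining reduction runs in parallel with \<open>q\<close>; performing the two one after the
  other would cost a depth of order \<open>(log n)\<^sup>2\<close>.\<close>

lemma doubling:
  assumes "finite X" "X \<noteq> {}" "card X \<le> 6 * 2 ^ (i + j)" "finite K" "card K = 3 * 2 ^ i" "X \<inter> K = {}"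
  shows "\<exists>os z. reduces os X K z \<and> layers_suffice (ops_circuit os) (70 * (j + 1) + 10 * (i + j))"
  using assms
proof (induction j arbitrary: i X K)
  case (0 i X K)
  have "card K \<noteq> 0" unfolding 0(5) by simp
  then have "K \<noteq> {}" by (metis card.empty)
  then obtain e where "e \<in> K" by blast
  then have "card (K - {e}) + 1 = 3 * 2 ^ i"
    using card.remove[OF 0(4)] 0(5) by simp
  moreover have d: "X \<inter> (K - {e}) = {}" using 0 by auto
  ultimately obtain p q z where b: "reduces (p @ q) X (K - {e}) z" "layers_suffice (ops_circuit p) 60"
    "layers_suffice (ops_circuit q) (10 * i)"
    using block[OF 0(1,2) _ _ _ d, of i] 0(3,4) by auto
  have "layers_suffice (ops_circuit (p @ q)) (70 * (0 + 1) + 10 * (i + 0))"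
    unfolding ops_circuit_simps using layers_suffice_append[OF b(2,3)]
    by (rule layers_suffice_mono) simp
  then show ?case using reduces_mono[OF b(1), of K] by blast
next
  case (Suc j i X K)
  have cK: "card K = 3 * 2 ^ i" by (fact Suc.prems(5))
  then have "card K \<noteq> 0" by simp
  then have "K \<noteq> {}" by (metis card.empty)
  \<comment> \<open>One clean qubit is kept back for joining the block with the rest; the remaining
    \<open>3 * 2 ^ i - 1\<close> are what \<open>block\<close> needs.\<close>
  then obtain e where e: "e \<in> K" by blast
  define K1 where "K1 = K - {e}"
  have K1: "card K1 + 1 = 3 * 2 ^ i" "finite K1" "K1 \<subseteq> K" "e \<notin> K1"
    using card.remove[OF Suc.prems(4) e] Suc.prems(4) cK by (auto simp: K1_def)
  show ?case
  proof (cases "card X \<le> 6 * 2 ^ i")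
    case True
    then obtain p q z where b: "reduces (p @ q) X K1 z" "layers_suffice (ops_circuit p) 60"
      "layers_suffice (ops_circuit q) (10 * i)"
      using block[of X i K1] Suc.prems K1 by blast
    have "layers_suffice (ops_circuit (p @ q)) (70 * (Suc j + 1) + 10 * (i + Suc j))"
      unfolding ops_circuit_simps using layers_suffice_append[OF b(2,3)]
      by (rule layers_suffice_mono) simp
    then show ?thesis using reduces_mono[OF b(1) K1(3)] by blast
  next
    case False
    then obtain X1 where X1: "X1 \<subseteq> X" "card X1 = 6 * 2 ^ i" by (meson obtain_subset_with_card_n nat_le_linear)
    define Y where "Y = X - X1"
    have fX: "finite X1" "finite Y" using X1 Suc.prems finite_subset by (auto simp: Y_def)
    have X: "X = X1 \<union> Y" "X1 \<inter> Y = {}" using X1 by (auto simp: Y_def)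
    have "card Y = card X - 6 * 2 ^ i" using X1 fX by (simp add: Y_def card_Diff_subset)
    then have Y: "Y \<noteq> {}" "card Y \<le> 6 * 2 ^ (Suc i + j)" using False Suc.prems(3) by auto
    have "X1 \<noteq> {}" using X1 by auto
    moreover have d1: "X1 \<inter> K1 = {}" using X1(1) K1(3) Suc.prems(6) by blast
    ultimately obtain p q z A where b: "reduces (p @ q) X1 K1 z" "layers_suffice (ops_circuit p) 60"
      "layers_suffice (ops_circuit q) (10 * i)"
      "A \<subseteq> X1 \<union> K1" "card X1 \<le> card A" "A \<inter> (ops_qubits q \<union> {z}) = {}"
      using block[OF fX(1) _ _ K1(2,1) d1] X1(2) by auto
    \<comment> \<open>The size \<open>6 * 2 ^ i = 3 * 2 ^ Suc i\<close> is the supply required at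
      the next index. Since \<open>A\<close> avoids \<open>z\<close>, the result of the block is not
      overwritten.\<close>
    obtain L where L: "L \<subseteq> A" "card L = 6 * 2 ^ i" using b(5) X1 by (metis obtain_subset_with_card_n)
    have fL: "finite L" using L by (simp add: card_ge_0_finite)
    have YL: "Y \<inter> L = {}" using L b(4) X K1(3) Suc.prems(6) by blast
    have "card L = 3 * 2 ^ Suc i" using L by simp
    then obtain os y where o: "reduces os Y L y"
      "layers_suffice (ops_circuit os) (70 * (j + 1) + 10 * (Suc i + j))"
      using Suc.IH[OF fX(2) Y fL _ YL] by blast
    have "reduces ((p @ q) @ os @ [(z, y, e)]) (X1 \<union> Y) K e"
      using X K1 Suc.prems(6) b(4,6) L e fX by (intro reduces_join[OF b(1) o(1)]) auto
    then have r: "reduces (p @ (q @ os) @ [(z, y, e)]) X K e" using X(1) by simp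
    have "ops_qubits os \<subseteq> Y \<union> L" "ops_qubits q \<subseteq> X1 \<union> K1" using o b by (auto simp: reduces_def)
    then have "ops_qubits q \<inter> ops_qubits os = {}"
      using b(6) L X K1(3) Suc.prems(6) by blast
    \<comment> \<open>The \<open>10 * i\<close> layers of \<open>q\<close> fit within the bound for
      \<open>os\<close>, so \<open>q\<close> adds no depth.\<close>
    then have "layers_suffice (ops_circuit (q @ os)) (70 * (j + 1) + 10 * (Suc i + j))"
      unfolding ops_circuit_simps
      by (intro layers_suffice_parallel o layers_suffice_mono[OF b(3)]) (auto simp: circuit_qubits_ops)
    \<comment> \<open>Each level adds 60 layers for \<open>p\<close> and 10 for the joining
      operation, while the term \<open>10 * (i + j)\<close> is unchanged because
      \<open>Suc i + j = i + Suc j\<close>.\<close>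
    then have "layers_suffice (ops_circuit p @ ops_circuit (q @ os) @ op_circuit (z, y, e))
        (60 + (70 * (j + 1) + 10 * (Suc i + j) + 10))"
      by (intro layers_suffice_append b layers_suffice_op)
    then have "layers_suffice (ops_circuit (p @ (q @ os) @ [(z, y, e)])) (70 * (Suc j + 1) + 10 * (i + Suc j))"
      by (simp del: op_circuit.simps add: algebra_simps)
    with r show ?thesis by blast
  qed
qed

text \<open>The reduction stops at three qubits \<open>a\<close>, \<open>b\<close>,
  \<open>c\<close>, as the exact gate with three controls takes over there; \<open>g\<close> is its
  dirty ancilla, in an arbitrary state.\<close>

lemma toffoli_ops:
  assumes n: "n \<ge> 3" "n \<le> 2 ^ j"
  shows "\<exists>os a b c g. (\<forall>p\<in>set os. distinct_op p) \<and> ops_qubits os \<subseteq> {..<n} \<union> {n + 1} \<and>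
    length os + 3 = n \<and> distinct [a, b, c, g] \<and> {a, b, c, g} \<subseteq> {..<n} \<union> {n + 1} \<and>
    layers_suffice (ops_circuit os) (80 * j + 90) \<and>
    (\<forall>i. bit i (n + 1) \<longrightarrow> (bit (ops_fun os i) a \<and> bit (ops_fun os i) b \<and> bit (ops_fun os i) c
      \<longleftrightarrow> (\<forall>k<n. bit i k)))"
proof -
  consider "n = 3" | "n = 4" | "n \<ge> 5" using n by linarith
  then show ?thesis
  proof cases
    case 1
    have "layers_suffice (ops_circuit []) (80 * j + 90)"
      using layers_suffice_mono[OF layers_suffice_length[of "[]"]] by simp
    then show ?thesis using 1
      by - (rule exI[of _ "[]"], rule exI[of _ 0], rule exI[of _ 1], rule exI[of _ 2],
        rule exI[of _ "n + 1"], auto simp: numeral_3_eq_3 less_Suc_eq numeral_2_eq_2)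
  next
    case 2
    have "layers_suffice (ops_circuit [(0, 1, n + 1)]) (80 * j + 90)"
      using layers_suffice_mono[OF layers_suffice_op, of "80 * j + 90" "(0, 1, n + 1)"]
      by (simp del: op_circuit.simps)
    moreover have all4: "(\<forall>k<4. bit i k) \<longleftrightarrow> bit i 0 \<and> bit i 1 \<and> bit i 2 \<and> bit i 3" for i :: nat
    proof -
      have "k < 4 \<longleftrightarrow> k = 0 \<or> k = 1 \<or> k = 2 \<or> k = 3" for k :: nat by auto
      then show ?thesis by (simp only:) blast
    qed
    ultimately show ?thesis using 2
      by - (rule exI[of _ "[(0, 1, n + 1)]"], rule exI[of _ 2], rule exI[of _ 3], rule exI[of _ "n + 1"],
        rule exI[of _ 0], auto simp: all4 bit_flip_bit_iff simp del: op_circuit.simps)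
  next
    case 3
    define X where "X = {4..<n}"
    have "card X \<le> 6 * 2 ^ (0 + j)" using n by (simp add: X_def)
    moreover have "card {1, 2, 3::nat} = 3 * 2 ^ 0" by simp
    ultimately obtain os z where r: "reduces os X {1, 2, 3} z"
      and l: "layers_suffice (ops_circuit os) (70 * (j + 1) + 10 * (0 + j))"
      using doubling[of X 0 j "{1, 2, 3}"] 3 by (auto simp: X_def)
    have q: "ops_qubits os \<subseteq> X \<union> {1, 2, 3}" and z: "z \<in> X \<union> {1, 2, 3}"
      and d: "\<forall>p\<in>set os. distinct_op p" and len: "length os + 1 = n - 4"
      and spec: "\<And>i. (\<forall>k\<in>{1, 2, 3}. bit i k) \<Longrightarrow> bit (ops_fun os i) z \<longleftrightarrow> (\<forall>x\<in>X. bit i x)"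
      using r by (auto simp: reduces_def X_def)
    \<comment> \<open>The ancilla receives the conjunction of qubits 0 and 1; then qubit 0, now
      conditionally clean, receives that of 2 and 3. If both results are 1, qubits 1, 2 and 3 are
      clean, the \<open>3 * 2 ^ 0\<close> qubits with which \<open>doubling\<close> starts. The
      count is \<open>2 + (n - 5) = n - 3\<close>.\<close>
    let ?p = "(0, 1, n + 1) :: op" and ?r = "(2, 3, 0) :: op"
    let ?os = "[?p] @ [?r] @ os"
    obtain g where g: "g \<in> {1, 2, 3::nat}" "g \<noteq> z"
      by (metis insertCI numeral_eq_one_iff semiring_norm(85))
    have "layers_suffice (op_circuit ?p @ op_circuit ?r @ ops_circuit os)
      (10 + (10 + (70 * (j + 1) + 10 * (0 + j))))"
      by (intro layers_suffice_append layers_suffice_op l)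
    then have layers: "layers_suffice (ops_circuit ?os) (80 * j + 90)"
      by (simp del: op_circuit.simps add: algebra_simps)
    have main: "bit (ops_fun ?os i) (n + 1) \<and> bit (ops_fun ?os i) 0 \<and> bit (ops_fun ?os i) z
      \<longleftrightarrow> (\<forall>k<n. bit i k)" if a: "bit i (n + 1)" for i
    proof -
      have nq: "n + 1 \<notin> ops_qubits os" "0 \<notin> ops_qubits os" using q 3 by (auto simp: X_def)
      have o: "bit (ops_fun ?os i) (n + 1) \<longleftrightarrow> bit (op_fun ?r (op_fun ?p i)) (n + 1)"
        "bit (ops_fun ?os i) 0 \<longleftrightarrow> bit (op_fun ?r (op_fun ?p i)) 0"
        by (simp_all only: append_Cons append_Nil ops_fun_simps bit_ops_fun_other[OF nq(1)]
          bit_ops_fun_other[OF nq(2)])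
      have 1: "bit (ops_fun ?os i) (n + 1) \<longleftrightarrow> bit i 0 \<and> bit i 1"
        unfolding o bit_op_fun using a 3 by simp
      have 2: "bit (ops_fun ?os i) 0 \<longleftrightarrow> bit i 2 \<and> bit i 3" if "bit i 0" "bit i 1"
        unfolding o bit_op_fun using that 3 by simp
      have 3: "bit (ops_fun ?os i) z \<longleftrightarrow> (\<forall>x\<in>X. bit i x)"
        if "bit i 0" "bit i 1" "bit i 2" "bit i 3"
        using that spec[of i] by simp
      have "{..<n} = {0, 1, 2, 3} \<union> X" using \<open>n \<ge> 5\<close> by (auto simp: X_def)
      then have "(\<forall>k<n. bit i k) \<longleftrightarrow> (\<forall>k\<in>{0, 1, 2, 3} \<union> X. bit i k)"
        by (metis lessThan_iff)
      then show ?thesis using 1 2 3 by auto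
    qed
    have "ops_qubits ?os \<subseteq> {..<n} \<union> {n + 1}" using q 3 by (auto simp: X_def)
    moreover have "distinct [n + 1, 0, z, g]" "{n + 1, 0, z, g} \<subseteq> {..<n} \<union> {n + 1}"
      using z g 3 by (auto simp: X_def)
    moreover have "\<forall>p\<in>set ?os. distinct_op p" using d 3 by simp
    moreover have "length ?os + 3 = n" using len 3 by simp
    moreover have "\<forall>i. bit i (n + 1) \<longrightarrow>
      (bit (ops_fun ?os i) (n + 1) \<and> bit (ops_fun ?os i) 0 \<and> bit (ops_fun ?os i) z
        \<longleftrightarrow> (\<forall>k<n. bit i k))"
      using main by blast
    ultimately show ?thesis using layers
      by - (rule exI[of _ ?os], rule exI[of _ "n + 1"], rule exI[of _ 0], rule exI[of _ z],
        rule exI[of _ g], intro conjI)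
  qed
qed

section \<open>Action of circuits on amplitudes\<close>

text \<open>Amplitudes are functions on all of \<open>nat\<close>, which avoids dimensions and index
  bounds. Precomposition is right for CNOT because its basis permutation is an involution.\<close>

fun apply_gate :: "gate \<Rightarrow> (nat \<Rightarrow> complex) \<Rightarrow> nat \<Rightarrow> complex" where
  "apply_gate (Single U q) f i =
     (if bit i q then U $$ (1, 1) * f i + U $$ (1, 0) * f (flip_bit q i)
      else U $$ (0, 0) * f i + U $$ (0, 1) * f (flip_bit q i))"
| "apply_gate (CNOT c t) f i = f (if bit i c then flip_bit t i else i)"

fun apply_circuit :: "circuit \<Rightarrow> (nat \<Rightarrow> complex) \<Rightarrow> nat \<Rightarrow> complex" where
  "apply_circuit [] f = f"
| "apply_circuit (g # gs) f = apply_circuit gs (apply_gate g f)"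

lemma apply_circuit_append: "apply_circuit (a @ b) f = apply_circuit b (apply_circuit a f)"
  by (induction a arbitrary: f) auto

lemma flip_bit_flip_bit [simp]: "flip_bit q (flip_bit q i) = (i::nat)"
  by (rule bit_eqI) (auto simp: bit_flip_bit_iff)

lemma flip_bit_commute: "flip_bit q (flip_bit r i) = flip_bit r (flip_bit q (i::nat))"
  by (rule bit_eqI) (auto simp: bit_flip_bit_iff)

lemma bit_flip_bit_nat [simp]: "bit (flip_bit q i) r \<longleftrightarrow> (if q = r then \<not> bit i r else bit i r)" for i :: nat
  by (auto simp: bit_flip_bit_iff)

lemma flip_bit_less: "i < 2 ^ m \<Longrightarrow> q < m \<Longrightarrow> flip_bit q i < (2::nat) ^ m"
  by (metis take_bit_flip_bit_eq take_bit_nat_eq_self_iff linorder_not_le)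

lemma unset_bit_eq_iff: "unset_bit q i = unset_bit q j \<longleftrightarrow> j = i \<or> j = flip_bit q (i::nat)"
proof
  assume "unset_bit q i = unset_bit q j"
  then have u: "bit (unset_bit q i) r = bit (unset_bit q j) r" for r by simp
  have r: "bit i r = bit j r" if "r \<noteq> q" for r
    using that u[of r] by (auto simp: bit_unset_bit_iff)
  show "j = i \<or> j = flip_bit q i"
  proof (cases "bit i q = bit j q")
    case True
    then have "j = i" using r by (intro bit_eqI) metis
    then show ?thesis ..
  next
    case False
    then have "j = flip_bit q i" using r by (intro bit_eqI) auto
    then show ?thesis ..
  qed
next
  assume "j = i \<or> j = flip_bit q i"
  then show "unset_bit q i = unset_bit q j"
    by (intro bit_eqI) (auto simp: bit_unset_bit_iff)
qed

text \<open>For an involution, \<open>i = h j\<close> is equivalent to \<open>j = h i\<close>, so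
  each row of the matrix selects one amplitude.\<close>

lemma basis_map_mat_mult_vec:
  assumes "\<And>j. j < 2 ^ m \<Longrightarrow> h j < 2 ^ m" "\<And>j. h (h j) = j"
  shows "basis_map_mat m h *\<^sub>v vec (2 ^ m) f = vec (2 ^ m) (\<lambda>i. f (h i))"
proof (rule eq_vecI)
  fix i assume "i < dim_vec (vec (2 ^ m) (\<lambda>i. f (h i)))"
  then have i: "i < 2 ^ m" by simp
  have "(basis_map_mat m h *\<^sub>v vec (2 ^ m) f) $ i = (\<Sum>j<2 ^ m. (if i = h j then 1 else 0) * f j)"
    using i by (simp add: basis_map_mat_def scalar_prod_def lessThan_atLeast0)
  also have "\<dots> = (\<Sum>j<2 ^ m. if j = h i then f j else 0)"
    using assms(2) by (intro sum.cong) auto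
  also have "\<dots> = f (h i)" using assms(1)[OF i] by (simp add: sum.delta)
  finally show "(basis_map_mat m h *\<^sub>v vec (2 ^ m) f) $ i = vec (2 ^ m) (\<lambda>i. f (h i)) $ i"
    using i by simp
qed (simp add: basis_map_mat_def)

lemma gate_mat_carrier: "gate_mat m g \<in> carrier_mat (2 ^ m) (2 ^ m)"
  by (cases g) (simp_all add: basis_map_mat_def)

lemma circuit_mat_carrier: "circuit_mat m gs \<in> carrier_mat (2 ^ m) (2 ^ m)"
  by (induction gs) (simp_all add: mult_carrier_mat gate_mat_carrier)

lemma gate_mat_mult_vec:
  assumes "valid_gate m g"
  shows "gate_mat m g *\<^sub>v vec (2 ^ m) f = vec (2 ^ m) (apply_gate g f)"
proof (cases g)
  case (CNOT c t)
  then have "apply_gate g f = (\<lambda>i. f (if bit i c then flip_bit t i else i))"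
    by (simp add: fun_eq_iff)
  then show ?thesis using assms CNOT
    by (simp add: flip_bit_less basis_map_mat_mult_vec)
next
  case (Single U q)
  then have q: "q < m" using assms by simp
  show ?thesis
  proof (rule eq_vecI)
    fix i assume "i < dim_vec (vec (2 ^ m) (apply_gate g f))"
    then have i: "i < 2 ^ m" by simp
    let ?h = "\<lambda>j. (if unset_bit q i = unset_bit q j
      then U $$ (of_bool (bit i q), of_bool (bit j q)) else 0) * f j"
    have "(gate_mat m g *\<^sub>v vec (2 ^ m) f) $ i = (\<Sum>j<2 ^ m. ?h j)"
      using i by (simp add: Single scalar_prod_def lessThan_atLeast0)
    also have "\<dots> = (\<Sum>j\<in>{i, flip_bit q i}. ?h j)"
      using i q by (intro sum.mono_neutral_right) (auto simp: flip_bit_less unset_bit_eq_iff)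
    also have "\<dots> = ?h i + ?h (flip_bit q i)"
    proof -
      have "bit (flip_bit q i) q \<noteq> bit i q" by simp
      then have "i \<noteq> flip_bit q i" by metis
      then show ?thesis by simp
    qed
    also have "\<dots> = apply_gate g f i" by (auto simp: Single unset_bit_eq_iff)
    finally show "(gate_mat m g *\<^sub>v vec (2 ^ m) f) $ i = vec (2 ^ m) (apply_gate g f) $ i"
      using i by simp
  qed (use gate_mat_carrier[of m g] in simp)
qed

lemma circuit_mat_mult_vec:
  "valid_circuit m gs \<Longrightarrow> circuit_mat m gs *\<^sub>v vec (2 ^ m) f = vec (2 ^ m) (apply_circuit gs f)"
proof (induction gs arbitrary: f)
  case (Cons g gs)
  have v: "valid_gate m g" "valid_circuit m gs" using Cons.prems by (auto simp: valid_circuit_def)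
  have "circuit_mat m (g # gs) *\<^sub>v vec (2 ^ m) f
    = circuit_mat m gs *\<^sub>v (gate_mat m g *\<^sub>v vec (2 ^ m) f)"
    unfolding circuit_mat.simps
    by (rule assoc_mult_mat_vec[OF circuit_mat_carrier gate_mat_carrier vec_carrier])
  then show ?case by (simp only: gate_mat_mult_vec[OF v(1)] Cons.IH[OF v(2)] apply_circuit.simps)
qed simp

section \<open>Inverse circuits\<close>

fun adjoint_gate :: "gate \<Rightarrow> gate" where
  "adjoint_gate (Single U q) = Single (mat_adjoint U) q"
| "adjoint_gate (CNOT c t) = CNOT c t"

definition inverse_circuit :: "circuit \<Rightarrow> circuit" where
  "inverse_circuit gs = rev (map adjoint_gate gs)"

lemma mat_adjoint_index:
  "U \<in> carrier_mat m n \<Longrightarrow> i < n \<Longrightarrow> j < m \<Longrightarrow> mat_adjoint U $$ (i, j) = cnj (U $$ (j, i))"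
  by (simp add: mat_adjoint_def mat_of_rows_index)

lemma mat_adjoint_carrier: "U \<in> carrier_mat m n \<Longrightarrow> mat_adjoint U \<in> carrier_mat n m"
  by (intro carrier_matI) (simp_all add: mat_adjoint_def)

lemma mat_adjoint_adjoint:
  assumes U: "U \<in> carrier_mat m n"
  shows "mat_adjoint (mat_adjoint U) = (U :: complex mat)"
proof -
  have A: "mat_adjoint U \<in> carrier_mat n m" by (rule mat_adjoint_carrier[OF U])
  show ?thesis
    using U mat_adjoint_carrier[OF A]
    by (intro eq_matI) (auto simp: mat_adjoint_index[OF U] mat_adjoint_index[OF A])
qed

lemma mult_mat_index_2:
  assumes "A \<in> carrier_mat 2 2" "B \<in> carrier_mat 2 2" "i < 2" "j < 2"
  shows "(A * B) $$ (i, j) = A $$ (i, 0) * B $$ (0, j) + A $$ (i, 1) * B $$ (1, j)"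
  using assms by (simp add: scalar_prod_def numeral_2_eq_2)

lemma valid_adjoint_gate: "valid_gate m g \<Longrightarrow> valid_gate m (adjoint_gate g)"
  by (cases g) (auto simp: unitary_mat_def mat_adjoint_carrier mat_adjoint_adjoint)

lemma apply_adjoint_gate:
  assumes "valid_gate m g"
  shows "apply_gate (adjoint_gate g) (apply_gate g f) = f"
proof (cases g)
  case (Single U q)
  let ?A = "mat_adjoint U"
  have U: "U \<in> carrier_mat 2 2" and A: "?A \<in> carrier_mat 2 2" and AU: "?A * U = 1\<^sub>m 2"
    using assms Single by (auto simp: unitary_mat_def mat_adjoint_carrier)
  have e: "?A $$ (i, 0) * U $$ (0, j) + ?A $$ (i, 1) * U $$ (1, j) = (if i = j then 1 else 0)"
    if "i < 2" "j < 2" for i j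
    using mult_mat_index_2[OF A U that] AU that by simp
  show ?thesis
  proof
    fix i
    have "apply_gate (adjoint_gate g) (apply_gate g f) i =
      (if bit i q
       then (?A $$ (1, 0) * U $$ (0, 1) + ?A $$ (1, 1) * U $$ (1, 1)) * f i +
         (?A $$ (1, 0) * U $$ (0, 0) + ?A $$ (1, 1) * U $$ (1, 0)) * f (flip_bit q i)
       else (?A $$ (0, 0) * U $$ (0, 0) + ?A $$ (0, 1) * U $$ (1, 0)) * f i +
         (?A $$ (0, 0) * U $$ (0, 1) + ?A $$ (0, 1) * U $$ (1, 1)) * f (flip_bit q i))"
      by (simp add: Single algebra_simps)
    also have "\<dots> = f i" using e[of 0 0] e[of 0 1] e[of 1 0] e[of 1 1] by simp
    finally show "apply_gate (adjoint_gate g) (apply_gate g f) i = f i" .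
  qed
qed (use assms in \<open>auto simp: fun_eq_iff\<close>)

lemma valid_circuit_append [simp]:
  "valid_circuit m (a @ b) \<longleftrightarrow> valid_circuit m a \<and> valid_circuit m b"
  by (auto simp: valid_circuit_def)

lemma valid_inverse_circuit: "valid_circuit m gs \<Longrightarrow> valid_circuit m (inverse_circuit gs)"
  by (auto simp: valid_circuit_def inverse_circuit_def valid_adjoint_gate)

lemma apply_inverse_circuit:
  "valid_circuit m gs \<Longrightarrow> apply_circuit (inverse_circuit gs) (apply_circuit gs f) = f"
proof (induction gs arbitrary: f)
  case (Cons g gs)
  then show ?case
    using apply_adjoint_gate[of m g f]
    by (simp add: inverse_circuit_def apply_circuit_append valid_circuit_def)
qed (simp add: inverse_circuit_def)

lemma cnot_count_append [simp]: "cnot_count (a @ b) = cnot_count a + cnot_count b"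
  by (simp add: cnot_count_def)

lemma cnot_count_inverse: "cnot_count (inverse_circuit gs) = cnot_count gs"
proof -
  have "is_CNOT (adjoint_gate g) = is_CNOT g" for g by (cases g) auto
  then show ?thesis by (simp add: cnot_count_def inverse_circuit_def rev_filter[symmetric] filter_map o_def)
qed

text \<open>Adjoint gates act on the same qubits, so it suffices to number the layers
  backwards.\<close>

lemma layers_suffice_inverse:
  assumes "layers_suffice gs d"
  shows "layers_suffice (inverse_circuit gs) d"
proof -
  obtain L where L: "layering gs d L" using assms by (auto simp: layers_suffice_def)
  have q: "gate_qubits (adjoint_gate g) = gate_qubits g" for g by (cases g) auto
  let ?m = "length gs"
  have nth: "gate_qubits (inverse_circuit gs ! i) = gate_qubits (gs ! (?m - Suc i))" if "i < ?m" for i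
    using that by (simp add: inverse_circuit_def rev_nth q)
  have "layering (inverse_circuit gs) d (\<lambda>i. d - Suc (L (?m - Suc i)))"
    unfolding layering_def
  proof (intro conjI allI impI)
    fix i assume "i < length (inverse_circuit gs)"
    then have "L (?m - Suc i) < d" using L by (simp add: layering_def inverse_circuit_def)
    then show "d - Suc (L (?m - Suc i)) < d" by simp
  next
    fix i j
    assume ij: "i < j \<and> j < length (inverse_circuit gs) \<and>
      gate_qubits (inverse_circuit gs ! i) \<inter> gate_qubits (inverse_circuit gs ! j) \<noteq> {}"
    then have "j < ?m" "i < ?m" by (auto simp: inverse_circuit_def)
    then have "?m - Suc j < ?m - Suc i" "?m - Suc i < ?m"
      "gate_qubits (gs ! (?m - Suc j)) \<inter> gate_qubits (gs ! (?m - Suc i)) \<noteq> {}"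
      using ij nth by (auto simp: Int_commute)
    then have "L (?m - Suc j) < L (?m - Suc i)" "L (?m - Suc i) < d"
      using L unfolding layering_def by blast+
    then show "d - Suc (L (?m - Suc i)) < d - Suc (L (?m - Suc j))" by simp
  qed
  then show ?thesis by (auto simp: layers_suffice_def)
qed

section \<open>Unitarity and action of the elementary gates\<close>

lemma t_phase_simps:
  "t_phase * cnj t_phase = 1" "t_phase * t_phase = \<i>" "cnj t_phase * cnj t_phase = - \<i>"
  by (simp_all add: t_phase_def complex_eq_iff field_simps)

lemma inv_sqrt2_simps:
  "cnj inv_sqrt2 = inv_sqrt2" "inv_sqrt2 * inv_sqrt2 = 1 / 2" "inv_sqrt2 * (inv_sqrt2 * x) = x / 2"
proof -
  show sq: "inv_sqrt2 * inv_sqrt2 = 1 / 2" by (simp add: inv_sqrt2_def flip: of_real_mult)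
  show "inv_sqrt2 * (inv_sqrt2 * x) = x / 2" using sq by (simp flip: mult.assoc)
qed (simp add: inv_sqrt2_def)

lemma unitary_hadamard: "unitary_mat 2 hadamard"
proof -
  have c: "hadamard \<in> carrier_mat 2 2" by (simp add: hadamard_def)
  have "mat_adjoint hadamard = hadamard"
    using mat_adjoint_carrier[OF c] c
    by (intro eq_matI) (auto simp: mat_adjoint_index[OF c], auto simp: hadamard_def inv_sqrt2_simps)
  moreover have "hadamard * hadamard = 1\<^sub>m 2"
    by (intro eq_matI)
      (auto simp: hadamard_def scalar_prod_def numeral_2_eq_2 less_Suc_eq inv_sqrt2_simps)
  ultimately show ?thesis using c by (simp add: unitary_mat_def)
qed

lemma unitary_phase_mat:
  assumes "p * cnj p = 1"
  shows "unitary_mat 2 (phase_mat p)"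
proof -
  have c: "phase_mat q \<in> carrier_mat 2 2" for q by (simp add: phase_mat_def)
  have "mat_adjoint (phase_mat p) = phase_mat (cnj p)"
    using mat_adjoint_carrier[OF c[of p]] c[of "cnj p"]
    by (intro eq_matI) (auto simp: mat_adjoint_index[OF c], auto simp: phase_mat_def)
  moreover have "phase_mat q * phase_mat r = phase_mat (q * r)" for q r
    by (intro eq_matI) (auto simp: phase_mat_def scalar_prod_def numeral_2_eq_2 less_Suc_eq)
  moreover have "phase_mat 1 = 1\<^sub>m 2" by (intro eq_matI) (auto simp: phase_mat_def less_2_cases_iff)
  ultimately show ?thesis using c assms by (simp add: unitary_mat_def mult.commute)
qed

lemma unitary_pauli_x: "unitary_mat 2 pauli_x"
proof -
  have c: "pauli_x \<in> carrier_mat 2 2" by (simp add: pauli_x_def)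
  have "mat_adjoint pauli_x = pauli_x"
    using mat_adjoint_carrier[OF c] c
    by (intro eq_matI) (auto simp: mat_adjoint_index[OF c], auto simp: pauli_x_def)
  moreover have "pauli_x * pauli_x = 1\<^sub>m 2"
    by (intro eq_matI) (auto simp: pauli_x_def scalar_prod_def numeral_2_eq_2 less_Suc_eq)
  ultimately show ?thesis using c by (simp add: unitary_mat_def)
qed

lemma apply_hadamard:
  "apply_gate (Single hadamard q) f i =
    inv_sqrt2 * (if bit i q then f (flip_bit q i) - f i else f i + f (flip_bit q i))"
  by (simp add: hadamard_def algebra_simps)

lemma apply_phase: "apply_gate (Single (phase_mat p) q) f i = (if bit i q then p * f i else f i)"
  by (simp add: phase_mat_def)

lemma apply_pauli_x: "apply_gate (Single pauli_x q) f i = f (flip_bit q i)"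
  by (simp add: pauli_x_def)

section \<open>Toffoli gates\<close>

lemma valid_op_circuit:
  assumes "distinct_op p" "op_qubits p \<subseteq> {..<m}"
  shows "valid_circuit m (op_circuit p)"
  using assms
  by (cases p) (auto simp: valid_circuit_def unitary_hadamard unitary_pauli_x unitary_phase_mat
    t_phase_simps mult.commute)

lemma valid_ops_circuit:
  "(\<And>p. p \<in> set os \<Longrightarrow> distinct_op p) \<Longrightarrow> ops_qubits os \<subseteq> {..<m} \<Longrightarrow> valid_circuit m (ops_circuit os)"
proof (induction os)
  case (Cons p os)
  then show ?case by (simp add: valid_op_circuit del: op_circuit.simps)
qed (simp add: valid_circuit_def)

lemma cnot_count_ops: "cnot_count (ops_circuit os) = 3 * length os"
proof (induction os)
  case (Cons p os)
  have "cnot_count (op_circuit p) = 3" by (cases p) (simp add: cnot_count_def)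
  with Cons show ?case by simp
qed (simp add: cnot_count_def)

text \<open>The phase that \<open>op_circuit p\<close> attaches to the basis state \<open>i\<close>
  while sending it to \<open>op_fun p i\<close>.\<close>

definition op_phase :: "op \<Rightarrow> nat \<Rightarrow> complex" where
  "op_phase p i = (case p of (u, v, w) \<Rightarrow>
     if \<not> bit i u then 1
     else if \<not> bit i v then (if bit i w then - 1 else 1)
     else (if bit i w then - \<i> else \<i>))"

lemma t_phase_mult:
  "t_phase * (cnj t_phase * x) = x" "cnj t_phase * (t_phase * x) = x"
  "t_phase * (t_phase * x) = \<i> * x" "cnj t_phase * (cnj t_phase * x) = - (\<i> * x)"
  using t_phase_simps by (metis mult.assoc mult.commute mult_1 mult_minus_left)+

text \<open>Between the Hadamard gates, the gates on \<open>w\<close> multiply to the identity if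
  \<open>u\<close> is 0, to \<open>X\<close> if only \<open>u\<close> is 1, and to
  \<open>i Z X\<close> if both controls are 1. The Hadamard gates turn these into the identity,
  \<open>Z\<close> and \<open>i X Z\<close>; the final \<open>X\<close> gives \<open>op_fun\<close>
  with the stated phases.\<close>

lemma apply_op_circuit:
  assumes "distinct_op p"
  shows "apply_circuit (op_circuit p) f (op_fun p i) = op_phase p i * f i"
proof (cases p)
  case (fields u v w)
  have d: "u \<noteq> v" "u \<noteq> w" "v \<noteq> w" "v \<noteq> u" "w \<noteq> u" "w \<noteq> v" using assms fields by auto
  show ?thesis
    using d unfolding fields op_circuit.simps op_phase_def
    by (cases "bit i u"; cases "bit i v"; cases "bit i w")
      (simp_all add: apply_hadamard apply_phase apply_pauli_x t_phase_simps t_phase_mult inv_sqrt2_simps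
        del: apply_gate.simps(1), simp_all add: algebra_simps inv_sqrt2_simps t_phase_mult)
qed

text \<open>The textbook decomposition of the exact Toffoli gate into Clifford and T gates, with six
  CNOT gates.\<close>

definition ccnot_circuit :: "nat \<Rightarrow> nat \<Rightarrow> nat \<Rightarrow> circuit" where
  "ccnot_circuit u v t =
     [Single hadamard t, CNOT v t, Tdg_gate t, CNOT u t, T_gate t, CNOT v t, Tdg_gate t, CNOT u t,
      T_gate v, T_gate t, Single hadamard t, CNOT u v, T_gate u, Tdg_gate v, CNOT u v]"

lemma valid_ccnot_circuit:
  "u \<noteq> v \<Longrightarrow> u \<noteq> t \<Longrightarrow> v \<noteq> t \<Longrightarrow> u < m \<Longrightarrow> v < m \<Longrightarrow> t < m \<Longrightarrow> valid_circuit m (ccnot_circuit u v t)"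
  by (auto simp: ccnot_circuit_def valid_circuit_def unitary_hadamard unitary_phase_mat
    t_phase_simps mult.commute)

lemma apply_ccnot_circuit:
  assumes d: "u \<noteq> v" "u \<noteq> t" "v \<noteq> t"
  shows "apply_circuit (ccnot_circuit u v t) f i = f (if bit i u \<and> bit i v then flip_bit t i else i)"
proof -
  show ?thesis
    using d d[symmetric] unfolding ccnot_circuit_def
    by (cases "bit i u"; cases "bit i v"; cases "bit i t")
      (simp_all add: apply_hadamard apply_phase t_phase_simps t_phase_mult inv_sqrt2_simps flip_bit_commute[of v t]
        del: apply_gate.simps(1), simp_all add: algebra_simps inv_sqrt2_simps t_phase_mult)
qed

lemma op_fun_op_fun: "distinct_op p \<Longrightarrow> op_fun p (op_fun p i) = i"
proof (cases p)
  case (fields u v w)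
  assume "distinct_op p"
  then show ?thesis unfolding fields
    by (intro bit_eqI) (simp only: bit_op_fun, auto)
qed

text \<open>Amplitudes after \<open>ops_circuit\<close> are known at arguments
  \<open>ops_fun os i\<close>; surjectivity makes these all arguments.\<close>

lemma ops_fun_surj: "(\<And>p. p \<in> set os \<Longrightarrow> distinct_op p) \<Longrightarrow> \<exists>k. ops_fun os k = i"
proof (induction os)
  case (Cons p os)
  then obtain k where "ops_fun os k = i" by auto
  then have "ops_fun (p # os) (op_fun p k) = i" using Cons.prems by (simp add: op_fun_op_fun del: op_fun.simps)
  then show ?case ..
qed simp

lemma op_fun_flip_bit: "t \<notin> op_qubits p \<Longrightarrow> op_fun p (flip_bit t i) = flip_bit t (op_fun p i)"
  by (cases p) (auto simp: flip_bit_commute)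

lemma ops_fun_flip_bit: "t \<notin> ops_qubits os \<Longrightarrow> ops_fun os (flip_bit t i) = flip_bit t (ops_fun os i)"
  by (induction os arbitrary: i) (auto simp: op_fun_flip_bit simp del: op_fun.simps)

text \<open>The phases multiply along the list. Their product need not be known: the cancellation
  uses only that it ignores untouched qubits.\<close>

lemma apply_ops_circuit:
  assumes "\<And>p. p \<in> set os \<Longrightarrow> distinct_op p"
  obtains \<phi> where "\<And>f i. apply_circuit (ops_circuit os) f (ops_fun os i) = \<phi> i * f i"
    and "\<And>t i. t \<notin> ops_qubits os \<Longrightarrow> \<phi> (flip_bit t i) = \<phi> i"
proof -
  have "\<exists>\<phi>. (\<forall>f i. apply_circuit (ops_circuit os) f (ops_fun os i) = \<phi> i * f i) \<and>
    (\<forall>t i. t \<notin> ops_qubits os \<longrightarrow> \<phi> (flip_bit t i) = \<phi> i)"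
    using assms
  proof (induction os)
    case Nil
    show ?case by (rule exI[of _ "\<lambda>_. 1"]) simp
  next
    case (Cons p os)
    then obtain \<phi> where \<phi>: "\<And>f i. apply_circuit (ops_circuit os) f (ops_fun os i) = \<phi> i * f i"
      "\<And>t i. t \<notin> ops_qubits os \<Longrightarrow> \<phi> (flip_bit t i) = \<phi> i"
      by (metis list.set_intros(2))
    have p: "distinct_op p" using Cons.prems by simp
    have "apply_circuit (ops_circuit (p # os)) f (ops_fun (p # os) i) = \<phi> (op_fun p i) * op_phase p i * f i" for f i
      by (simp add: apply_circuit_append \<phi> apply_op_circuit p del: op_circuit.simps op_fun.simps)
    moreover have "op_phase p (flip_bit t i) = op_phase p i" if "t \<notin> op_qubits p" for t i
      using that by (cases p) (auto simp: op_phase_def)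
    ultimately show ?case
      by (intro exI[of _ "\<lambda>i. \<phi> (op_fun p i) * op_phase p i"])
        (simp add: \<phi> op_fun_flip_bit del: op_circuit.simps op_fun.simps)
  qed
  then show ?thesis using that by blast
qed

text \<open>The phases do not depend on the target \<open>t\<close>, so they cancel although the operations are
  Toffoli gates only up to phase.\<close>

lemma apply_conjugated:
  assumes os: "\<And>p. p \<in> set os \<Longrightarrow> distinct_op p" "valid_circuit m (ops_circuit os)" "t \<notin> ops_qubits os"
    and M: "\<And>f i. apply_circuit M f i = f (if c i then flip_bit t i else i)"
  shows "apply_circuit (ops_circuit os @ M @ inverse_circuit (ops_circuit os)) f i =
    f (if c (ops_fun os i) then flip_bit t i else i)"
proof -
  let ?U = "apply_circuit (ops_circuit os)"
  define h where "h = (\<lambda>i. if c (ops_fun os i) then flip_bit t i else i)"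
  obtain \<phi> where \<phi>: "\<And>f i. ?U f (ops_fun os i) = \<phi> i * f i"
    and inv: "\<And>i. \<phi> (flip_bit t i) = \<phi> i"
    using apply_ops_circuit[OF os(1)] os(3) by metis
  \<comment> \<open>Once \<open>M\<close> is moved across \<open>?U\<close>, the inverse circuit
    cancels \<open>?U\<close> together with its phases.\<close>
  have "apply_circuit M (?U f) = ?U (\<lambda>i. f (h i))"
  proof
    fix k
    obtain i where k: "ops_fun os i = k" using ops_fun_surj[OF os(1)] by metis
    have "apply_circuit M (?U f) k = ?U f (ops_fun os (h i))"
      using os(3) by (simp add: M h_def ops_fun_flip_bit flip: k)
    also have "\<dots> = \<phi> i * f (h i)" by (simp add: \<phi>) (simp add: h_def inv)
    also have "\<dots> = ?U (\<lambda>i. f (h i)) k" by (simp add: \<phi> flip: k)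
    finally show "apply_circuit M (?U f) k = ?U (\<lambda>i. f (h i)) k" .
  qed
  then show ?thesis
    by (simp add: apply_circuit_append apply_inverse_circuit[OF os(2)] h_def)
qed

text \<open>The two halves flip the target by \<open>c \<and> (g \<longleftrightarrow> a \<and> b)\<close> and by \<open>c \<and> \<not> g\<close>, so the unknown value of the
  dirty ancilla \<open>g\<close> drops out of their composition.\<close>

definition c3not_circuit :: "nat \<Rightarrow> nat \<Rightarrow> nat \<Rightarrow> nat \<Rightarrow> nat \<Rightarrow> circuit" where
  "c3not_circuit a b c g t =
     (ops_circuit [(a, b, g)] @ ccnot_circuit g c t @ inverse_circuit (ops_circuit [(a, b, g)])) @
     [Single pauli_x g] @ ccnot_circuit g c t @ [Single pauli_x g]"

lemma apply_c3not_circuit: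
  assumes d: "distinct [a, b, c, g, t]" and m: "{a, b, c, g, t} \<subseteq> {..<m}"
  shows "apply_circuit (c3not_circuit a b c g t) f i =
    f (if bit i a \<and> bit i b \<and> bit i c then flip_bit t i else i)"
proof -
  let ?c = "\<lambda>i. bit i g \<and> bit i c"
  have "valid_circuit m (ops_circuit [(a, b, g)])"
    using d m by (intro valid_ops_circuit) auto
  then have 1: "apply_circuit (ops_circuit [(a, b, g)] @ ccnot_circuit g c t @
      inverse_circuit (ops_circuit [(a, b, g)])) f k =
      f (if ?c (ops_fun [(a, b, g)] k) then flip_bit t k else k)" for f k
    using d by (intro apply_conjugated) (auto simp: apply_ccnot_circuit)
  have 2: "apply_circuit ([Single pauli_x g] @ ccnot_circuit g c t @ [Single pauli_x g]) f k =
      f (if \<not> bit k g \<and> bit k c then flip_bit t k else k)" for f k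
    using d by (auto simp: apply_circuit_append apply_ccnot_circuit apply_pauli_x flip_bit_commute[of g t]
        simp del: apply_gate.simps(1))
  show ?thesis
    \<comment> \<open>With \<open>c\<close> set, for \<open>g = 1\<close> the first half flips the
      target iff \<open>a\<close> and \<open>b\<close> hold and the second does nothing; for
      \<open>g = 0\<close> the first flips it iff \<open>a\<close> and \<open>b\<close> do not both
      hold and the second always flips it.\<close>
    unfolding c3not_circuit_def apply_circuit_append[of "_ @ _"] 2 1
    using d by auto
qed

lemma valid_c3not_circuit:
  assumes "distinct [a, b, c, g, t]" "{a, b, c, g, t} \<subseteq> {..<m}"
  shows "valid_circuit m (c3not_circuit a b c g t)"
proof -
  have "valid_circuit m (ops_circuit [(a, b, g)])"
    using assms by (intro valid_ops_circuit) auto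
  moreover have "valid_circuit m (ccnot_circuit g c t)"
    using assms by (intro valid_ccnot_circuit) auto
  moreover have "valid_circuit m [Single pauli_x g]"
    using assms by (simp add: valid_circuit_def unitary_pauli_x)
  ultimately show ?thesis
    by (simp only: c3not_circuit_def valid_circuit_append valid_inverse_circuit simp_thms)
qed

section \<open>The complete circuit, its correctness and its cost\<close>

lemma tensor_ket0:
  assumes "v \<in> carrier_vec N"
  shows "tensor_vec v ket0 = vec (N * 2) (\<lambda>i. if i < N then v $ i else 0)"
proof (rule eq_vecI)
  fix i assume "i < dim_vec (vec (N * 2) (\<lambda>i. if i < N then v $ i else 0))"
  then have i: "i < N * 2" by simp
  then have "i div N < 2" by (simp add: less_mult_imp_div_less mult.commute)
  \<comment> \<open>The ancilla is the most significant bit, so tensoring with \<open>ket0\<close>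
    is padding by zeros.\<close>
  moreover have "i div N = 0 \<longleftrightarrow> i < N" using i by (auto simp: div_eq_0_iff)
  ultimately show "tensor_vec v ket0 $ i = vec (N * 2) (\<lambda>i. if i < N then v $ i else 0) $ i"
    using assms i by (auto simp: tensor_vec_def ket0_def)
qed (use assms in \<open>simp add: tensor_vec_def ket0_def\<close>)

text \<open>The outer \<open>X\<close> gates convert the ancilla between its initial value 0 and the
  clean value 1 of the operations. The trailing CNOT gates cancel in pairs and only adjust the
  count.\<close>

definition toffoli_circuit :: "nat \<Rightarrow> op list \<Rightarrow> circuit \<Rightarrow> nat \<Rightarrow> circuit" where
  "toffoli_circuit n os M k =
     [Single pauli_x (n + 1)] @ (ops_circuit os @ M @ inverse_circuit (ops_circuit os)) @
     [Single pauli_x (n + 1)] @ replicate (2 * k) (CNOT 0 n)"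

lemma apply_cnot_even: "apply_circuit (replicate (2 * k) (CNOT c t)) f = f" if "c \<noteq> t"
proof (induction k arbitrary: f)
  case (Suc k)
  have "apply_gate (CNOT c t) (apply_gate (CNOT c t) f) = f"
    using that by (auto simp: fun_eq_iff)
  then show ?case using Suc by simp
qed simp

lemma implements_toffoli_circuit:
  assumes n: "n \<ge> 1"
    and os: "\<And>p. p \<in> set os \<Longrightarrow> distinct_op p" "ops_qubits os \<subseteq> {..<n} \<union> {n + 1}"
    and M: "valid_circuit (n + 2) M" "\<And>f i. apply_circuit M f i = f (if c i then flip_bit n i else i)"
    and spec: "\<And>i. bit i (n + 1) \<Longrightarrow> c (ops_fun os i) \<longleftrightarrow> (\<forall>k<n. bit i k)"
  shows "implements_toffoli_clean_ancilla n (toffoli_circuit n os M k)"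
proof -
  let ?gs = "toffoli_circuit n os M k"
  have U: "valid_circuit (n + 2) (ops_circuit os)"
    using os by (intro valid_ops_circuit) auto
  have "valid_circuit (n + 2) [Single pauli_x (n + 1)]"
    "valid_circuit (n + 2) (replicate (2 * k) (CNOT 0 n))"
    using n by (auto simp: valid_circuit_def unitary_pauli_x)
  then have valid: "valid_circuit (n + 2) ?gs"
    using U M(1) by (simp only: toffoli_circuit_def valid_circuit_append valid_inverse_circuit simp_thms)
  define h where "h = (\<lambda>j. if \<forall>k<n. bit j k then flip_bit n j else (j::nat))"
  have hh: "h (h j) = j" for j by (auto simp: h_def)
  have h_less: "h j < 2 ^ (n + 1)" if "j < 2 ^ (n + 1)" for j
    using that flip_bit_less[of j "n + 1" n] by (simp add: h_def)
  have nq: "n \<notin> ops_qubits os" using os(2) by auto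
  have conj: "apply_circuit (ops_circuit os @ M @ inverse_circuit (ops_circuit os)) f i =
      f (if c (ops_fun os i) then flip_bit n i else i)" for f i
    using os(1) by (rule apply_conjugated[OF _ U nq M(2)])
  have ap: "apply_circuit ?gs f i =
    f (if c (ops_fun os (flip_bit (n + 1) i)) then flip_bit n i else i)" for f i
  proof -
    have "apply_circuit ?gs f i = apply_gate (Single pauli_x (n + 1)) (apply_circuit
      (ops_circuit os @ M @ inverse_circuit (ops_circuit os)) (apply_gate (Single pauli_x (n + 1)) f)) i"
      using n unfolding toffoli_circuit_def
      by (simp add: apply_circuit_append apply_cnot_even del: apply_gate.simps)
    also have "\<dots> = f (if c (ops_fun os (flip_bit (n + 1) i)) then flip_bit n i else i)"
      by (simp add: conj apply_pauli_x flip_bit_commute[of "Suc n" n] del: apply_gate.simps)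
    finally show ?thesis .
  qed
  have "circuit_mat (n + 2) ?gs *\<^sub>v tensor_vec \<psi> ket0 = tensor_vec (toffoli n *\<^sub>v \<psi>) ket0"
    if "\<psi> \<in> qubit_states (n + 1)" for \<psi>
  proof -
    let ?N = "2 ^ (n + 1) :: nat"
    define F where "F = (\<lambda>i. if i < ?N then \<psi> $ i else 0)"
    have \<psi>: "\<psi> \<in> carrier_vec ?N" using that by (simp add: qubit_states_def)
    have N: "?N * 2 = 2 ^ (n + 2)" by simp
    have "\<psi> = vec ?N (($) \<psi>)" using \<psi> by (intro eq_vecI) auto
    then have tof: "toffoli n *\<^sub>v \<psi> = vec ?N (\<lambda>i. \<psi> $ h i)"
      using basis_map_mat_mult_vec[of "n + 1" h "($) \<psi>"] h_less hh
      unfolding toffoli_def h_def[symmetric] by metis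
    have "circuit_mat (n + 2) ?gs *\<^sub>v tensor_vec \<psi> ket0 = vec (2 ^ (n + 2)) (apply_circuit ?gs F)"
      unfolding tensor_ket0[OF \<psi>] N F_def[symmetric] by (rule circuit_mat_mult_vec[OF valid])
    also have "\<dots> = vec (2 ^ (n + 2)) (\<lambda>i. if i < ?N then \<psi> $ h i else 0)"
    proof (rule eq_vecI)
      fix i assume "i < dim_vec (vec (2 ^ (n + 2)) (\<lambda>i. if i < ?N then \<psi> $ h i else 0))"
      then have i: "i < 2 ^ (n + 2)" by simp
      have ge: "j \<ge> ?N" if "bit j (n + 1)" for j :: nat
        using that by (metis bit_take_bit_iff less_irrefl not_le take_bit_nat_eq_self)
      have "apply_circuit ?gs F i = (if i < ?N then \<psi> $ h i else 0)"
      proof (cases "bit i (n + 1)")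
        \<comment> \<open>The circuit as a whole moves amplitudes only along the target, so those
          with ancilla 1 stay zero.\<close>
        case True
        then have "i \<ge> ?N" "flip_bit n i \<ge> ?N" using ge[of i] ge[of "flip_bit n i"] by simp_all
        then show ?thesis unfolding ap F_def by auto
      next
        case False
        have "take_bit (n + 2) i = i" using i by (simp add: take_bit_nat_eq_self)
        then have nb: "\<not> bit i r" if "r \<ge> n + 1" for r
          using that False by (metis bit_take_bit_iff le_antisym not_less_eq_eq add_2_eq_Suc' Suc_eq_plus1 not_le)
        have "r < n + 1" if "bit i r" for r using nb[of r] that by (meson not_le)
        then have "take_bit (n + 1) i = i" by (intro bit_eqI) (auto simp: bit_take_bit_iff)
        then have iN: "i < ?N" using take_bit_nat_less_exp[of "n + 1" i] by simp
        have "(\<forall>k<n. bit (flip_bit (n + 1) i) k) \<longleftrightarrow> (\<forall>k<n. bit i k)" by auto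
        moreover have "bit (flip_bit (n + 1) i) (n + 1)" using False by simp
        ultimately have "c (ops_fun os (flip_bit (n + 1) i)) \<longleftrightarrow> (\<forall>k<n. bit i k)"
          using spec by blast
        then have "apply_circuit ?gs F i = F (h i)" unfolding ap by (simp add: h_def)
        then show ?thesis using iN h_less[OF iN] by (simp add: F_def)
      qed
      then show "vec (2 ^ (n + 2)) (apply_circuit ?gs F) $ i
        = vec (2 ^ (n + 2)) (\<lambda>i. if i < ?N then \<psi> $ h i else 0) $ i"
        using i by simp
    qed simp
    also have "\<dots> = vec (?N * 2) (\<lambda>i. if i < ?N then vec ?N (\<lambda>i. \<psi> $ h i) $ i else 0)"
      unfolding N by (intro eq_vecI) auto
    also have "\<dots> = tensor_vec (toffoli n *\<^sub>v \<psi>) ket0"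
      unfolding tof by (rule tensor_ket0[symmetric]) simp
    finally show ?thesis .
  qed
  then show ?thesis using valid by (simp add: implements_toffoli_clean_ancilla_def)
qed

lemma cnot_count_toffoli_circuit:
  "cnot_count (toffoli_circuit n os M k) = 6 * length os + cnot_count M + 2 * k"
proof -
  have "cnot_count (replicate l (CNOT 0 n)) = l" for l by (induction l) (auto simp: cnot_count_def)
  moreover have "cnot_count [Single pauli_x (n + 1)] = 0" by (simp add: cnot_count_def)
  ultimately show ?thesis
    by (simp only: toffoli_circuit_def cnot_count_append cnot_count_inverse cnot_count_ops)
qed

lemma depth_toffoli_circuit:
  assumes "layers_suffice (ops_circuit os) d"
  shows "depth (toffoli_circuit n os M k) \<le> 2 * d + length M + 2 * k + 2"
proof -
  have X: "layers_suffice [Single pauli_x (n + 1)] 1"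
    using layers_suffice_length[of "[Single pauli_x (n + 1)]"] by simp
  have R: "layers_suffice (replicate (2 * k) (CNOT 0 n)) (2 * k)"
    using layers_suffice_length[of "replicate (2 * k) (CNOT 0 n)"] by simp
  have "layers_suffice (toffoli_circuit n os M k) (1 + ((d + (length M + d)) + (1 + 2 * k)))"
    unfolding toffoli_circuit_def
    by (intro layers_suffice_append X R assms layers_suffice_length layers_suffice_inverse)
  then have "depth (toffoli_circuit n os M k) \<le> 1 + ((d + (length M + d)) + (1 + 2 * k))"
    by (rule depth_le)
  then show ?thesis by simp
qed

theorem theorem2:
  shows "\<exists>C::real. C > 0 \<and>
    (\<forall>n::nat. n \<ge> 1 \<longrightarrow>
      (\<exists>gs::circuit. implements_toffoli_clean_ancilla n gs \<and>
        cnot_count gs = 6 * n + 2 \<and>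
        real (depth gs) \<le> C * (1 + log 2 (real n))))"
\<comment> \<open>In the general case the depth is at most \<open>160 * j + 236\<close> with
  \<open>j <= log 2 n + 1\<close>, that is, at most \<open>160 * log 2 n + 396\<close>.\<close>
proof (intro exI[of _ "400 :: real"] conjI allI impI)
  fix n :: nat
  assume n: "n \<ge> 1"
  have log: "log 2 (real n) \<ge> 0" using n by simp
  then have bound: "400 \<le> 400 * (1 + log 2 (real n))" by simp
  have nil: "layers_suffice (ops_circuit []) 0"
    using layers_suffice_length[of "[]"] by simp
  have len_ccnot: "length (ccnot_circuit u v t) = 15" and count_ccnot: "cnot_count (ccnot_circuit u v t) = 6"
    for u v t by (simp_all add: ccnot_circuit_def cnot_count_def)
  consider "n = 1" | "n = 2" | "n \<ge> 3" using n by linarith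
  then show "\<exists>gs. implements_toffoli_clean_ancilla n gs \<and> cnot_count gs = 6 * n + 2 \<and>
    real (depth gs) \<le> 400 * (1 + log 2 (real n))"
  proof cases
    case 1
    \<comment> \<open>The ancilla, set to 1, is the second control. A single CNOT has odd count and
      could not be padded by pairs to 8.\<close>
    let ?gs = "toffoli_circuit n [] (ccnot_circuit 0 (n + 1) n) 1"
    have "implements_toffoli_clean_ancilla n ?gs"
      using 1 by (intro implements_toffoli_circuit[where c = "\<lambda>i. bit i 0 \<and> bit i (n + 1)"])
        (auto simp: valid_ccnot_circuit apply_ccnot_circuit)
    moreover have "cnot_count ?gs = 6 * n + 2"
      using 1 by (simp add: cnot_count_toffoli_circuit count_ccnot)
    moreover have "real (depth ?gs) \<le> 19"
      using depth_toffoli_circuit[OF nil, of n "ccnot_circuit 0 (n + 1) n" 1] by (simp add: len_ccnot)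
    then have "real (depth ?gs) \<le> 400" by linarith
    then have "real (depth ?gs) \<le> 400 * (1 + log 2 (real n))" using bound by (rule order_trans)
    ultimately show ?thesis by blast
  next
    case 2
    \<comment> \<open>Four cancelling pairs raise the count from 6 to 14.\<close>
    let ?gs = "toffoli_circuit n [] (ccnot_circuit 0 1 n) 4"
    have "(\<forall>k<2. bit i k) \<longleftrightarrow> bit i 0 \<and> bit i 1" for i :: nat
      by (auto simp: less_2_cases_iff)
    then have "implements_toffoli_clean_ancilla n ?gs"
      using 2 by (intro implements_toffoli_circuit[where c = "\<lambda>i. bit i 0 \<and> bit i 1"])
        (auto simp: valid_ccnot_circuit apply_ccnot_circuit)
    moreover have "cnot_count ?gs = 6 * n + 2"
      using 2 by (simp add: cnot_count_toffoli_circuit count_ccnot)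
    moreover have "real (depth ?gs) \<le> 25"
      using depth_toffoli_circuit[OF nil, of n "ccnot_circuit 0 1 n" 4] by (simp add: len_ccnot)
    then have "real (depth ?gs) \<le> 400" by linarith
    then have "real (depth ?gs) \<le> 400 * (1 + log 2 (real n))" using bound by (rule order_trans)
    ultimately show ?thesis by blast
  next
    case 3
    define j where "j = nat \<lceil>log 2 (real n)\<rceil>"
    have j: "log 2 (real n) \<le> real j" "real j \<le> log 2 (real n) + 1"
      using log by (simp_all add: j_def)
    then have "real n \<le> 2 powr real j" using n by (simp add: log_le_iff)
    then have "real n \<le> real (2 ^ j)" by (simp add: powr_realpow)
    then have nj: "n \<le> 2 ^ j" by (simp only: of_nat_le_iff)
    obtain os a b c g where os: "\<forall>p\<in>set os. distinct_op p" "ops_qubits os \<subseteq> {..<n} \<union> {n + 1}"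
      and len: "length os + 3 = n"
      and d: "distinct [a, b, c, g]" "{a, b, c, g} \<subseteq> {..<n} \<union> {n + 1}"
      and layers: "layers_suffice (ops_circuit os) (80 * j + 90)"
      and spec: "\<forall>i. bit i (n + 1) \<longrightarrow>
        (bit (ops_fun os i) a \<and> bit (ops_fun os i) b \<and> bit (ops_fun os i) c \<longleftrightarrow> (\<forall>k<n. bit i k))"
      using toffoli_ops[OF 3 nj] by (elim exE conjE) (rule that)
    let ?M = "c3not_circuit a b c g n"
    let ?gs = "toffoli_circuit n os ?M 1"
    have M: "distinct [a, b, c, g, n]" "{a, b, c, g, n} \<subseteq> {..<n + 2}" using d by auto
    have "implements_toffoli_clean_ancilla n ?gs"
      by (rule implements_toffoli_circuit[where c = "\<lambda>i. bit i a \<and> bit i b \<and> bit i c",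
            OF n _ os(2) valid_c3not_circuit[OF M] apply_c3not_circuit[OF M]])
        (use os(1) spec in blast)+
    moreover have "cnot_count [Single pauli_x g] = 0" by (simp add: cnot_count_def)
    \<comment> \<open>The conjugated half has \<open>3 + 6 + 3\<close> CNOT gates, the other half
      6.\<close>
    then have "cnot_count ?M = 18"
      by (simp only: c3not_circuit_def cnot_count_append cnot_count_inverse cnot_count_ops count_ccnot) simp
    then have "cnot_count ?gs = 6 * n + 2"
      using len by (simp add: cnot_count_toffoli_circuit)
    moreover have "real (depth ?gs) \<le> 400 * (1 + log 2 (real n))"
    proof -
      have "length ?M = 52"
        by (simp add: c3not_circuit_def inverse_circuit_def len_ccnot length_ops_circuit
          del: ops_circuit_simps)
      then have "depth ?gs \<le> 160 * j + 236"
        using depth_toffoli_circuit[OF layers, of n ?M 1] by simp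
      then have "real (depth ?gs) \<le> 160 * real j + 236" by linarith
      also have "\<dots> \<le> 400 * (1 + log 2 (real n))" using j log by (simp add: distrib_left)
      finally show ?thesis .
    qed
    ultimately show ?thesis by blast
  qed
qed simp

end
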